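(* Let $k\geqslant1$, $t\ge0$, $n\geqslant1$, $0\leqslant r\leqslant kt$, and let $a_0,\dots,a_t,x$ be independent variables. Then \[ \operatorname{Tr}\Bigl(\bigl(\Pi_{r,t}^{[k]}(a_0,a_1x,a_2x^2,\dots,a_tx^t)\bigr)^n\Bigr)=x^{rn}\operatorname{Tr}\Bigl(\bigl(\Pi_{r,t}^{[k]}(a_0,a_1,\dots,a_t)\bigr)^n\Bigr). \]
   Context: $i^{\langle l\rangle}$ denotes $i$ repeated $l$ times; $G_{r,t}^{[k]}=\{(1^{\langle l_1\rangle},\dots,t^{\langle l_t\rangle}):0\le l_i\le k,\ \sum l_i=r\}$. The matrix $\Pi_{r,t}^{[k]}(a_0,\dots,a_t)$ is indexed by $G_{r,t}^{[k]}$: $\Pi_{0,0}^{[k]}=k!a_0^k$; for $t\ge1$ and $\overline\alpha=(1^{\langle l_1\rangle},\dots,t^{\langle l_t\rangle})\in G_{r,t}^{[k]}$, entry $(\overline\alpha,\overline\beta)$ is $k!\binom{k}{l_t+\sum_{i=1}^{t-1}p_i}\prod_{i=1}^{t-1}\binom{l_i}{p_i}\,a_0^{k-l_t-\sum p_i}a_1^{p_1}\cdots a_{t-1}^{p_{t-1}}a_t^{l_t}$ if $\overline\beta=(1^{\langle l_t+\sum_{i=1}^{t-1}p_i\rangle},2^{\langle l_1-p_1\rangle},\dots,t^{\langle l_{t-1}-p_{t-1}\rangle})$ with integers $0\le p_i\le l_i$ and $\sum p_i\le k-l_t$; $0$ otherwise. *)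

theory Defs
  imports "Jordan_Normal_Form.Matrix" "HOL-Library.Multiset"
begin

(* The tuple (1^{<l_1>}, ..., t^{<l_t>}) is the multiset in which i has multiplicity l_i. *)
definition G_set :: "nat \<Rightarrow> nat \<Rightarrow> nat \<Rightarrow> nat multiset set" where
  "G_set k r t = {\<alpha> \<in> multisets_of_size {1..t} r. \<forall>i\<in>{1..t}. count \<alpha> i \<le> k}"

lemma finite_G_set: "finite (G_set k r t)"
  by (rule finite_subset[of _ "multisets_of_size {1..t} r"])
    (auto simp: G_set_def finite_multisets_of_size)

(* Only the values p 1, ..., p (t - 1) matter.  The second conjunct is sum p_i <= k - l_t,
   written without truncated subtraction. *)
definition Pi_admissible :: "nat \<Rightarrow> nat \<Rightarrow> nat multiset \<Rightarrow> (nat \<Rightarrow> nat) \<Rightarrow> bool" where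
  "Pi_admissible k t \<alpha> p \<longleftrightarrow>
     (\<forall>i\<in>{1..<t}. p i \<le> count \<alpha> i) \<and> count \<alpha> t + (\<Sum>i\<in>{1..<t}. p i) \<le> k"

definition Pi_target :: "nat \<Rightarrow> nat multiset \<Rightarrow> (nat \<Rightarrow> nat) \<Rightarrow> nat multiset" where
  "Pi_target t \<alpha> p =
     replicate_mset (count \<alpha> t + (\<Sum>i\<in>{1..<t}. p i)) 1
     + (\<Sum>i\<in>{1..<t}. replicate_mset (count \<alpha> i - p i) (i + 1))"

definition Pi_weight ::
    "nat \<Rightarrow> nat \<Rightarrow> (nat \<Rightarrow> 'a :: comm_ring_1) \<Rightarrow> nat multiset \<Rightarrow> (nat \<Rightarrow> nat) \<Rightarrow> 'a" where
  "Pi_weight k t a \<alpha> p =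
     of_nat (fact k * (k choose (count \<alpha> t + (\<Sum>i\<in>{1..<t}. p i)))
             * (\<Prod>i\<in>{1..<t}. count \<alpha> i choose p i))
     * a 0 ^ (k - count \<alpha> t - (\<Sum>i\<in>{1..<t}. p i))
     * (\<Prod>i\<in>{1..<t}. a i ^ p i) * a t ^ count \<alpha> t"

(* The choice of p is harmless: see Pi_entry_eq below. *)
definition Pi_entry ::
    "nat \<Rightarrow> nat \<Rightarrow> (nat \<Rightarrow> 'a :: comm_ring_1) \<Rightarrow> nat multiset \<Rightarrow> nat multiset \<Rightarrow> 'a" where
  "Pi_entry k t a \<alpha> \<beta> =
     (if t = 0 then of_nat (fact k) * a 0 ^ k
      else if \<exists>p. Pi_admissible k t \<alpha> p \<and> \<beta> = Pi_target t \<alpha> p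
      then Pi_weight k t a \<alpha> (SOME p. Pi_admissible k t \<alpha> p \<and> \<beta> = Pi_target t \<alpha> p)
      else 0)"

lemma count_Pi_target:
  assumes "j \<in> {1..<t}"
  shows "count (Pi_target t \<alpha> p) (Suc j) = count \<alpha> j - p j"
  using assms by (auto simp: Pi_target_def count_sum sum.delta)

lemma Pi_target_inj:
  assumes "Pi_admissible k t \<alpha> p" "Pi_admissible k t \<alpha> q"
    and "Pi_target t \<alpha> p = Pi_target t \<alpha> q" and "i \<in> {1..<t}"
  shows "p i = q i"
proof -
  have "count \<alpha> i - p i = count \<alpha> i - q i"
    using count_Pi_target[OF assms(4)] assms(3) by metis
  moreover have "p i \<le> count \<alpha> i" "q i \<le> count \<alpha> i"
    using assms by (auto simp: Pi_admissible_def)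
  ultimately show ?thesis by linarith
qed

lemma Pi_weight_cong:
  assumes "\<And>i. i \<in> {1..<t} \<Longrightarrow> p i = q i"
  shows "Pi_weight k t a \<alpha> p = Pi_weight k t a \<alpha> q"
proof -
  have "(\<Sum>i\<in>{1..<t}. p i) = (\<Sum>i\<in>{1..<t}. q i)"
    "(\<Prod>i\<in>{1..<t}. count \<alpha> i choose p i) = (\<Prod>i\<in>{1..<t}. count \<alpha> i choose q i)"
    "(\<Prod>i\<in>{1..<t}. a i ^ p i) = (\<Prod>i\<in>{1..<t}. a i ^ q i)"
    using assms by (auto intro!: sum.cong prod.cong)
  then show ?thesis
    unfolding Pi_weight_def by metis
qed

lemma Pi_entry_eq:
  assumes "t \<noteq> 0" "Pi_admissible k t \<alpha> p"
  shows "Pi_entry k t a \<alpha> (Pi_target t \<alpha> p) = Pi_weight k t a \<alpha> p"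
proof -
  let ?q = "SOME q. Pi_admissible k t \<alpha> q \<and> Pi_target t \<alpha> p = Pi_target t \<alpha> q"
  have q: "Pi_admissible k t \<alpha> ?q \<and> Pi_target t \<alpha> p = Pi_target t \<alpha> ?q"
    by (rule someI[of _ p]) (use assms in simp)
  have "Pi_weight k t a \<alpha> ?q = Pi_weight k t a \<alpha> p"
    by (rule Pi_weight_cong) (use q assms Pi_target_inj in metis)
  then show ?thesis
    using assms by (auto simp: Pi_entry_def)
qed

(* Rows and columns are indexed by G_set k r t through an enumeration gs of that set. *)
definition Pi_mat ::
    "nat \<Rightarrow> nat \<Rightarrow> nat multiset list \<Rightarrow> (nat \<Rightarrow> 'a :: comm_ring_1) \<Rightarrow> 'a mat" where
  "Pi_mat k t gs a =
     mat (length gs) (length gs) (\<lambda>(i, j). Pi_entry k t a (gs ! i) (gs ! j))"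

definition mat_trace :: "'a :: comm_monoid_add mat \<Rightarrow> 'a" where
  "mat_trace A = (\<Sum>i<dim_row A. A $$ (i, i))"

end

theory Submission
  imports Defs
begin

text \<open>Let \<open>s \<alpha> = \<Sum>i. i l\<^sub>i\<close> be the sum of the multiset \<open>\<alpha>\<close>. An admissible choice \<open>p\<close> taking \<open>\<alpha>\<close> to \<open>\<beta>\<close>
  contributes the exponent \<open>t l\<^sub>t + \<Sum>i. i p\<^sub>i = r + s \<alpha> - s \<beta>\<close> of \<open>x\<close>, so the substitution multiplies the
  \<open>(\<alpha>, \<beta>)\<close> entry by \<open>x\<close> to the power \<open>r + s \<alpha> - s \<beta>\<close>. Along a closed walk of length \<open>n\<close> the
  differences of \<open>s\<close> cancel, and \<open>x\<close> to the power \<open>r n\<close> remains. As \<open>x\<close> need not be invertible, this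
  cannot be phrased as conjugation by a diagonal matrix.\<close>

\<comment> \<open>The second condition keeps the truncated subtraction honest on nonzero entries.\<close>
definition graded_scaling ::
    "(nat \<Rightarrow> nat) \<Rightarrow> nat \<Rightarrow> 'a :: comm_ring_1 \<Rightarrow> nat \<Rightarrow> 'a mat \<Rightarrow> 'a mat \<Rightarrow> bool" where
  "graded_scaling s d x m A B \<longleftrightarrow> A \<in> carrier_mat d d \<and> B \<in> carrier_mat d d \<and>
     (\<forall>i<d. \<forall>j<d. B $$ (i, j) = x ^ (m + s i - s j) * A $$ (i, j) \<and>
        (A $$ (i, j) \<noteq> 0 \<longrightarrow> s j \<le> m + s i))"

lemma graded_scaling_one: "graded_scaling s d x 0 (1\<^sub>m d) (1\<^sub>m d)"
  by (auto simp: graded_scaling_def)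

text \<open>The two factors through an intermediate index \<open>l\<close> carry the exponents
  \<open>m + s i - s l\<close> and \<open>m' + s l - s j\<close>. Where \<open>A $$ (i, l)\<close>
  and \<open>A' $$ (l, j)\<close> are both nonzero, the subtractions are exact and
  \<open>s l\<close> cancels, so a power of \<open>x\<close> independent of \<open>l\<close> comes
  out of the sum.\<close>

lemma graded_scaling_mult:
  assumes "graded_scaling s d x m A B" and "graded_scaling s d x m' A' B'"
  shows "graded_scaling s d x (m + m') (A * A') (B * B')"
proof -
  have carr: "A \<in> carrier_mat d d" "B \<in> carrier_mat d d" "A' \<in> carrier_mat d d" "B' \<in> carrier_mat d d"
    using assms by (auto simp: graded_scaling_def)
  have entry: "(C * D) $$ (i, j) = (\<Sum>l<d. C $$ (i, l) * D $$ (l, j))"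
    if "C \<in> carrier_mat d d" "D \<in> carrier_mat d d" "i < d" "j < d" for C D :: "'a mat" and i j
    using that by (auto simp: scalar_prod_def atLeast0LessThan)
  have "(B * B') $$ (i, j) = x ^ (m + m' + s i - s j) * (A * A') $$ (i, j)"
    if ij: "i < d" "j < d" for i j
  proof -
    have "B $$ (i, l) * B' $$ (l, j) = x ^ (m + m' + s i - s j) * (A $$ (i, l) * A' $$ (l, j))"
      if l: "l < d" for l
    proof (cases "A $$ (i, l) = 0 \<or> A' $$ (l, j) = 0")
      \<comment> \<open>The matching entry of \<open>B\<close> or \<open>B'\<close> is a multiple of
        the vanishing one, so both sides are 0 even where a subtraction truncates.\<close>
      case True
      then show ?thesis using assms ij l by (auto simp: graded_scaling_def)
    next
      case False
      then have "s l \<le> m + s i" "s j \<le> m' + s l"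
        using assms ij l by (auto simp: graded_scaling_def)
      then have "m + m' + s i - s j = (m + s i - s l) + (m' + s l - s j)" by linarith
      then have "x ^ (m + m' + s i - s j) = x ^ (m + s i - s l) * x ^ (m' + s l - s j)"
        by (simp add: power_add)
      then show ?thesis
        using assms ij l by (simp add: graded_scaling_def mult_ac)
    qed
    then show ?thesis
      using carr ij by (simp add: entry sum_distrib_left del: index_mult_mat)
  qed
  moreover have "s j \<le> m + m' + s i"
    if ij: "i < d" "j < d" and nz: "(A * A') $$ (i, j) \<noteq> 0" for i j
  proof -
    obtain l where l: "l < d" "A $$ (i, l) * A' $$ (l, j) \<noteq> 0"
      using nz unfolding entry[OF carr(1,3) ij] by (auto elim: sum.not_neutral_contains_not_neutral)
    then have "A $$ (i, l) \<noteq> 0" "A' $$ (l, j) \<noteq> 0" by auto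
    then have "s l \<le> m + s i" "s j \<le> m' + s l"
      using assms ij l by (auto simp: graded_scaling_def)
    then show ?thesis by linarith
  qed
  ultimately show ?thesis
    using carr by (auto simp: graded_scaling_def simp del: index_mult_mat(1))
qed

lemma graded_scaling_pow:
  assumes "graded_scaling s d x m A B"
  shows "graded_scaling s d x (m * n) (A ^\<^sub>m n) (B ^\<^sub>m n)"
proof (induction n)
  case 0
  then show ?case
    using assms graded_scaling_one[of s d x] by (auto simp: graded_scaling_def)
next
  case (Suc n)
  show ?case
    using graded_scaling_mult[OF Suc assms] by (simp add: add.commute)
qed

text \<open>On the diagonal \<open>s i\<close> cancels against itself, leaving the exponent
  \<open>m\<close> at every position.\<close>

lemma mat_trace_graded_scaling:
  assumes "graded_scaling s d x m A B"
  shows "mat_trace B = x ^ m * mat_trace A"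
  using assms by (auto simp: graded_scaling_def mat_trace_def sum_distrib_left intro!: sum.cong)

lemma sum_mset_eq_sum_count:
  fixes \<alpha> :: "nat multiset"
  assumes "finite S" and "set_mset \<alpha> \<subseteq> S"
  shows "sum_mset \<alpha> = (\<Sum>i\<in>S. i * count \<alpha> i)"
  using assms(2)
proof (induction \<alpha>)
  case (add y \<alpha>)
  have "(\<Sum>i\<in>S. i * count (add_mset y \<alpha>) i) = (\<Sum>i\<in>S. i * count \<alpha> i + (if i = y then i else 0))"
    by (rule sum.cong) auto
  also have "\<dots> = (\<Sum>i\<in>S. i * count \<alpha> i) + y"
    using assms(1) add.prems by (simp add: sum.distrib)
  finally show ?case using add by simp
qed simp

lemma size_eq_sum_count:
  assumes "finite S" and "set_mset \<alpha> \<subseteq> S"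
  shows "size \<alpha> = (\<Sum>i\<in>S. count \<alpha> i)"
  unfolding size_multiset_overloaded_eq
  using assms by (intro sum.mono_neutral_left) (auto simp: not_in_iff)

text \<open>Raising every part of \<alpha> by one adds \<open>size \<alpha>\<close> to the sum.
  \<open>Pi_target\<close> differs from this by resetting to 1 the \<open>p i\<close> chosen copies
  of \<open>i\<close>, at a loss of \<open>i\<close> each, and all copies of \<open>t\<close>, at a
  loss of \<open>t\<close> each.\<close>

lemma sum_mset_Pi_target:
  assumes "t \<noteq> 0" and "set_mset \<alpha> \<subseteq> {1..t}" and "Pi_admissible k t \<alpha> p"
  shows "sum_mset (Pi_target t \<alpha> p) + ((\<Sum>i\<in>{1..<t}. i * p i) + t * count \<alpha> t)
    = size \<alpha> + sum_mset \<alpha>"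
proof -
  have split: "{1..t} = insert t {1..<t}" using assms(1) by auto
  have sum: "sum_mset \<alpha> = t * count \<alpha> t + (\<Sum>i\<in>{1..<t}. i * count \<alpha> i)"
    using sum_mset_eq_sum_count[OF _ assms(2)] unfolding split by simp
  have size: "size \<alpha> = count \<alpha> t + (\<Sum>i\<in>{1..<t}. count \<alpha> i)"
    using size_eq_sum_count[OF _ assms(2)] unfolding split by simp
  have sum_mset_sum: "sum_mset (sum f A) = (\<Sum>i\<in>A. sum_mset (f i))"
    for f :: "nat \<Rightarrow> nat multiset" and A
    by (induction A rule: infinite_finite_induct) auto
  have target: "sum_mset (Pi_target t \<alpha> p) = count \<alpha> t + (\<Sum>i\<in>{1..<t}. p i)
      + (\<Sum>i\<in>{1..<t}. (count \<alpha> i - p i) * (i + 1))"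
    by (simp add: Pi_target_def sum_mset_sum)
  have "p i + (count \<alpha> i - p i) * (i + 1) + i * p i = count \<alpha> i + i * count \<alpha> i"
    if "i \<in> {1..<t}" for i
  proof -
    have "p i \<le> count \<alpha> i" using assms(3) that by (auto simp: Pi_admissible_def)
    \<comment> \<open>Here \<open>c\<close> is the number of copies of \<open>i\<close> that move up
      to \<open>i + 1\<close>; it replaces the truncated difference.\<close>
    then obtain c where "count \<alpha> i = p i + c" using le_Suc_ex by blast
    then show ?thesis by (simp add: algebra_simps)
  qed
  then have "(\<Sum>i\<in>{1..<t}. p i + (count \<alpha> i - p i) * (i + 1) + i * p i)
      = (\<Sum>i\<in>{1..<t}. count \<alpha> i + i * count \<alpha> i)"
    by (rule sum.cong[OF refl])
  then have "(\<Sum>i\<in>{1..<t}. p i) + (\<Sum>i\<in>{1..<t}. (count \<alpha> i - p i) * (i + 1))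
      + (\<Sum>i\<in>{1..<t}. i * p i) = (\<Sum>i\<in>{1..<t}. count \<alpha> i) + (\<Sum>i\<in>{1..<t}. i * count \<alpha> i)"
    by (simp only: sum.distrib)
  then show ?thesis
    unfolding target sum size by linarith
qed

text \<open>The weight is a monomial in the \<open>a i\<close>. With \<open>a i\<close> given degree
  \<open>i\<close>, the power of \<open>a 0\<close> contributes nothing and the total degree is the
  exponent of \<open>x\<close>.\<close>

lemma Pi_weight_scale:
  "Pi_weight k t (\<lambda>i. a i * x ^ i) \<alpha> p
    = x ^ ((\<Sum>i\<in>{1..<t}. i * p i) + t * count \<alpha> t) * Pi_weight k t a \<alpha> p"
proof -
  have prod: "(\<Prod>i\<in>{1..<t}. (a i * x ^ i) ^ p i)
      = (\<Prod>i\<in>{1..<t}. a i ^ p i) * x ^ (\<Sum>i\<in>{1..<t}. i * p i)"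
    by (simp add: power_mult_distrib prod.distrib power_sum power_mult)
  have last: "(a t * x ^ t) ^ count \<alpha> t = a t ^ count \<alpha> t * x ^ (t * count \<alpha> t)"
    by (simp add: power_mult_distrib power_mult)
  show ?thesis
    unfolding Pi_weight_def prod last power_add power_0 mult_1_right by (simp only: mult_ac)
qed

text \<open>A nonzero entry comes from an admissible \<open>p\<close>, and
  \<open>sum_mset_Pi_target\<close> identifies the degree of its weight with the difference in the
  exponent, which is therefore not truncated.\<close>

lemma Pi_entry_scale:
  fixes a :: "nat \<Rightarrow> 'a :: comm_ring_1"
  assumes "t \<noteq> 0" and "\<alpha> \<in> G_set k r t"
  shows "Pi_entry k t (\<lambda>i. a i * x ^ i) \<alpha> \<beta>
      = x ^ (r + sum_mset \<alpha> - sum_mset \<beta>) * Pi_entry k t a \<alpha> \<beta>"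
    and "Pi_entry k t a \<alpha> \<beta> \<noteq> 0 \<Longrightarrow> sum_mset \<beta> \<le> r + sum_mset \<alpha>"
proof -
  have \<alpha>: "set_mset \<alpha> \<subseteq> {1..t}" "size \<alpha> = r"
    using assms(2) by (auto simp: G_set_def multisets_of_size_def)
  have zero: "Pi_entry k t b \<alpha> \<beta> = 0"
    if "\<nexists>p. Pi_admissible k t \<alpha> p \<and> \<beta> = Pi_target t \<alpha> p" for b :: "nat \<Rightarrow> 'a"
    using assms(1) that by (auto simp: Pi_entry_def)
  have deg: "sum_mset \<beta> + ((\<Sum>i\<in>{1..<t}. i * p i) + t * count \<alpha> t) = r + sum_mset \<alpha>"
    if "Pi_admissible k t \<alpha> p" "\<beta> = Pi_target t \<alpha> p" for p
    using sum_mset_Pi_target[OF assms(1) \<alpha>(1) that(1)] \<alpha>(2) that(2) by simp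
  show "Pi_entry k t (\<lambda>i. a i * x ^ i) \<alpha> \<beta>
      = x ^ (r + sum_mset \<alpha> - sum_mset \<beta>) * Pi_entry k t a \<alpha> \<beta>"
  proof (cases "\<exists>p. Pi_admissible k t \<alpha> p \<and> \<beta> = Pi_target t \<alpha> p")
    case True
    then obtain p where p: "Pi_admissible k t \<alpha> p" "\<beta> = Pi_target t \<alpha> p" by blast
    have "r + sum_mset \<alpha> - sum_mset \<beta> = (\<Sum>i\<in>{1..<t}. i * p i) + t * count \<alpha> t"
      using deg[OF p] by linarith
    then show ?thesis
      using Pi_weight_scale[of k t a x \<alpha> p] Pi_entry_eq[OF assms(1) p(1)] p(2) by metis
  qed (simp add: zero)
  show "sum_mset \<beta> \<le> r + sum_mset \<alpha>" if "Pi_entry k t a \<alpha> \<beta> \<noteq> 0"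
    using that zero deg by (metis le_add1)
qed

lemma graded_scaling_Pi_mat:
  assumes "r \<le> k * t" and "set gs = G_set k r t"
  shows "graded_scaling (\<lambda>i. sum_mset (gs ! i)) (length gs) x r
    (Pi_mat k t gs a) (Pi_mat k t gs (\<lambda>i. a i * x ^ i))"
proof (cases "t = 0")
  case True
  \<comment> \<open>For \<open>t = 0\<close> the bound on \<open>r\<close> forces
    \<open>r = 0\<close>, so only the empty multiset can be an index; its entry involves
    \<open>a 0\<close> alone and the exponent is 0.\<close>
  have "gs ! i = {#}" if "i < length gs" for i
  proof -
    have "gs ! i \<in> G_set k r t" using that assms(2) nth_mem by blast
    then show ?thesis using True assms(1) by (auto simp: G_set_def multisets_of_size_def)
  qed
  then show ?thesis
    using True assms(1) by (auto simp: graded_scaling_def Pi_mat_def Pi_entry_def)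
next
  case False
  have "gs ! i \<in> G_set k r t" if "i < length gs" for i
    using that assms(2) nth_mem by blast
  then show ?thesis
    unfolding graded_scaling_def Pi_mat_def
    by (auto intro!: Pi_entry_scale(1)[OF False] dest!: Pi_entry_scale(2)[OF False, rotated])
qed

theorem theorem15:
  fixes k t n r :: nat and a :: "nat \<Rightarrow> 'a :: comm_ring_1" and x :: 'a
    and gs :: "nat multiset list"
  assumes "k \<ge> 1" and "n \<ge> 1" and "r \<le> k * t"
    and "distinct gs" and "set gs = G_set k r t"
  shows "mat_trace (Pi_mat k t gs (\<lambda>i. a i * x ^ i) ^\<^sub>m n)
       = x ^ (r * n) * mat_trace (Pi_mat k t gs a ^\<^sub>m n)"
  by (rule mat_trace_graded_scaling[OF graded_scaling_pow[OF graded_scaling_Pi_mat[OF assms(3,5)]]])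

end
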